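(* Let $\mathcal{X}$ be a measurable space in which points are measurable, let $\nu$ be a probability measure on $\mathcal{X}$, let $s>0$, and let $C_{\boldsymbol{\theta}}:\mathcal{X}\times\mathcal{X}\to\mathbb{R}$ be a covariance kernel (with shape parameter $\boldsymbol{\theta}$) such that the space of measures $\mathcal{M}$ defined in the context contains $\nu$ and all Dirac measures $\delta_{\boldsymbol{t}}$, $\boldsymbol{t}\in\mathcal{X}$. Let the integrand $f$ be an instance of a zero mean Gaussian process on $\mathcal{X}$ with covariance $s^2C_{\boldsymbol{\theta}}$, drawn from a sample space $\mathcal{F}$. Let $\widehat{\nu}=\sum_{i=1}^n w_i\delta_{\boldsymbol{x}_i}$ be a deterministic sampling measure, with $n\in\mathbb{N}$, $w_i\in\mathbb{R}$, $\boldsymbol{x}_i\in\mathcal{X}$, and put $\mu=\int_{\mathcal{X}}f\,\mathrm{d}\nu$, $\widehat{\mu}=\int_{\mathcal{X}}f\,\mathrm{d}\widehat{\nu}=\sum_{i=1}^n w_if(\boldsymbol{x}_i)$. With $\mathrm{VAR}^{\mathrm{B}}$, $\mathrm{DSC}^{\mathrm{B}}$ and $\mathrm{CNF}^{\mathrm{B}}$ as defined in the context, $$\mu-\widehat{\mu}=\mathrm{CNF}^{\mathrm{B}}(f,\nu-\widehat{\nu})\;\mathrm{DSC}^{\mathrm{B}}(\nu-\widehat{\nu})\;\mathrm{VAR}^{\mathrm{B}}(f)\qquad\text{almost surely}.$$ Moreover, $\mathrm{CNF}^{\mathrm{B}}(f,\nu-\widehat{\nu})\sim\mathcal{N}(0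,1)$.
   Context: The space of measures is $$\mathcal{M}=\Bigl\{\eta:\Bigl|\int_{\mathcal{X}^2}C_{\boldsymbol{\theta}}(\boldsymbol{x},\boldsymbol{t})\,\eta(\mathrm{d}\boldsymbol{x})\,\eta(\mathrm{d}\boldsymbol{t})\Bigr|<\infty,\ \Bigl|\int_{\mathcal{X}}C_{\boldsymbol{\theta}}(\boldsymbol{x},\boldsymbol{t})\,\eta(\mathrm{d}\boldsymbol{t})\Bigr|<\infty\ \ \forall\boldsymbol{x}\in\mathcal{X}\Bigr\},$$ where $\eta$ ranges over signed measures on $\mathcal{X}$. Convention on Gaussian processes: vectors of linear functionals of $f$, including the integral $\int_{\mathcal{X}}f\,\mathrm{d}\nu$ and the point values $f(\boldsymbol{t})$, exist almost surely and have a zero mean multivariate Gaussian distribution, with covariances obtained by integrating $s^2C_{\boldsymbol{\theta}}$: $\mathbb{E}_f[f(\boldsymbol{x})f(\boldsymbol{t})]=s^2C_{\boldsymbol{\theta}}(\boldsymbol{x},\boldsymbol{t})$, $\mathbb{E}_f\bigl[f(\boldsymbol{x})\int f\,\mathrm{d}\nu\bigr]=s^2\int_{\mathcal{X}}C_{\boldsymbol{\theta}}(\boldsymbol{x},\boldsymbol{t})\,\nu(\mathrm{d}\boldsymbol{t})$, $\mathbb{E}_f\bigl[\bigl(\int f\,\mathrm{d}\nu\bigr)^2\bigr]=s^2c_0$, with $c_0$ as below. Define $$c_0=\int_{\mathcal{X}^2}C_{\boldsymbol{\theta}}(\boldsymbol{x},\boldsymbol{t})\,\nu(\mathrm{d}\boldsymbol{x})\,\nu(\mathrm{d}\boldsymbol{t}),\quad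 \boldsymbol{c}=\Bigl(\int_{\mathcal{X}}C_{\boldsymbol{\theta}}(\boldsymbol{x}_i,\boldsymbol{t})\,\nu(\mathrm{d}\boldsymbol{t})\Bigr)_{i=1}^n,\quad \mathsf{C}=\bigl(C_{\boldsymbol{\theta}}(\boldsymbol{x}_i,\boldsymbol{x}_j)\bigr)_{i,j=1}^n,\quad \boldsymbol{w}=(w_i)_{i=1}^n.$$ The Bayesian variation, discrepancy and confounding are $$\mathrm{VAR}^{\mathrm{B}}(f)=s,\qquad \mathrm{DSC}^{\mathrm{B}}(\nu-\widehat{\nu})=\sqrt{c_0-2\boldsymbol{c}^T\boldsymbol{w}+\boldsymbol{w}^T\mathsf{C}\boldsymbol{w}},$$ $$\mathrm{CNF}^{\mathrm{B}}(f,\nu-\widehat{\nu}):=\frac{\int_{\mathcal{X}}f(\boldsymbol{x})\,(\nu-\widehat{\nu})(\mathrm{d}\boldsymbol{x})}{s\sqrt{c_0-2\boldsymbol{c}^T\boldsymbol{w}+\boldsymbol{w}^T\mathsf{C}\boldsymbol{w}}},$$ where the denominator in the last formula is understood to be nonzero. *)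

theory Defs
  imports "HOL-Probability.Probability"
begin

section \<open>Finite signed measures\<close>

text \<open>A signed measure on the measurable space \<open>X\<close> is a real-valued set function; only its values
  on \<^term>\<open>sets X\<close> matter. A finite measure \<open>N\<close> is the signed measure \<^term>\<open>measure N\<close>.\<close>

definition signed_measure :: "'a measure \<Rightarrow> ('a set \<Rightarrow> real) \<Rightarrow> bool" where
  "signed_measure X \<eta> \<longleftrightarrow>
     (\<forall>A :: nat \<Rightarrow> 'a set. range A \<subseteq> sets X \<longrightarrow> disjoint_family A \<longrightarrow>
        (\<lambda>i. \<eta> (A i)) sums \<eta> (\<Union>i. A i))"

text \<open>Jordan decomposition; \<^const>\<open>ennreal\<close> sends negative reals to 0, which is harmless because
  \<open>B = {}\<close> is admissible in the supremum.\<close>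

definition pos_var :: "'a measure \<Rightarrow> ('a set \<Rightarrow> real) \<Rightarrow> 'a measure" where
  "pos_var X \<eta> =
     measure_of (space X) (sets X) (\<lambda>A. SUP B\<in>{B \<in> sets X. B \<subseteq> A}. ennreal (\<eta> B))"

definition neg_var :: "'a measure \<Rightarrow> ('a set \<Rightarrow> real) \<Rightarrow> 'a measure" where
  "neg_var X \<eta> = pos_var X (\<lambda>A. - \<eta> A)"

definition total_var :: "'a measure \<Rightarrow> ('a set \<Rightarrow> real) \<Rightarrow> 'a measure" where
  "total_var X \<eta> =
     measure_of (space X) (sets X) (\<lambda>A. emeasure (pos_var X \<eta>) A + emeasure (neg_var X \<eta>) A)"

text \<open>As for the Bochner integral, the value is 0 by convention if the integral does not exist.\<close>

definition signed_integral :: "'a measure \<Rightarrow> ('a set \<Rightarrow> real) \<Rightarrow> ('a \<Rightarrow> real) \<Rightarrow> real" where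
  "signed_integral X \<eta> g =
     (if integrable (total_var X \<eta>) g
      then (\<integral>t. g t \<partial>pos_var X \<eta>) - (\<integral>t. g t \<partial>neg_var X \<eta>) else 0)"

section \<open>Covariance kernels and the space of measures\<close>

definition covariance_kernel :: "'a set \<Rightarrow> ('a \<Rightarrow> 'a \<Rightarrow> real) \<Rightarrow> bool" where
  "covariance_kernel S C \<longleftrightarrow>
     (\<forall>x\<in>S. \<forall>t\<in>S. C x t = C t x) \<and>
     (\<forall>J a. finite J \<longrightarrow> J \<subseteq> S \<longrightarrow> 0 \<le> (\<Sum>x\<in>J. \<Sum>t\<in>J. a x * a t * C x t))"

text \<open>A Lebesgue integral with respect to a signed measure is finite iff the integrand is integrable
  with respect to the total variation. For the double integral this is the total variation of
  the product, namely the product of the total variations.\<close>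

definition kernel_measures :: "'a measure \<Rightarrow> ('a \<Rightarrow> 'a \<Rightarrow> real) \<Rightarrow> ('a set \<Rightarrow> real) set" where
  "kernel_measures X C = {\<eta>. signed_measure X \<eta> \<and>
     integrable (total_var X \<eta> \<Otimes>\<^sub>M total_var X \<eta>) (\<lambda>(x, t). C x t) \<and>
     (\<forall>x\<in>space X. integrable (total_var X \<eta>) (\<lambda>t. C x t))}"

section \<open>Gaussian processes\<close>

text \<open>Degenerate (almost surely constant) variables count as Gaussian.\<close>

definition gaussian_rv :: "'w measure \<Rightarrow> ('w \<Rightarrow> real) \<Rightarrow> bool" where
  "gaussian_rv F Z \<longleftrightarrow> Z \<in> borel_measurable F \<and>
     ((\<exists>m \<sigma>. 0 < \<sigma> \<and> distributed F lborel Z (normal_density m \<sigma>)) \<or>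
      (\<exists>m. AE \<omega> in F. Z \<omega> = m))"

text \<open>All finite subvectors of \<open>(Z i)\<^sub>i\<^sub>\<in>\<^sub>I\<close> are multivariate Gaussian (every linear combination of the
  components is a Gaussian variable) with mean zero and covariances \<open>K\<close>.\<close>

definition centered_gaussian_family ::
    "'w measure \<Rightarrow> 'i set \<Rightarrow> ('i \<Rightarrow> 'w \<Rightarrow> real) \<Rightarrow> ('i \<Rightarrow> 'i \<Rightarrow> real) \<Rightarrow> bool" where
  "centered_gaussian_family F I Z K \<longleftrightarrow>
     (\<forall>J a. finite J \<longrightarrow> J \<subseteq> I \<longrightarrow> gaussian_rv F (\<lambda>\<omega>. \<Sum>i\<in>J. a i * Z i \<omega>)) \<and>
     (\<forall>i\<in>I. (\<integral>\<omega>. Z i \<omega> \<partial>F) = 0) \<and>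
     (\<forall>i\<in>I. \<forall>j\<in>I. (\<integral>\<omega>. Z i \<omega> * Z j \<omega> \<partial>F) = K i j)"

definition kernel_c0 :: "('a \<Rightarrow> 'a \<Rightarrow> real) \<Rightarrow> 'a measure \<Rightarrow> real" where
  "kernel_c0 C \<nu> = (\<integral>(x, t). C x t \<partial>(\<nu> \<Otimes>\<^sub>M \<nu>))"

definition kernel_mean :: "('a \<Rightarrow> 'a \<Rightarrow> real) \<Rightarrow> 'a measure \<Rightarrow> 'a \<Rightarrow> real" where
  "kernel_mean C \<nu> x = (\<integral>t. C x t \<partial>\<nu>)"

text \<open>The linear functionals of an integrand are indexed by \<^typ>\<open>'a option\<close>: \<^const>\<open>None\<close> is the
  integral with respect to \<open>\<nu>\<close>, and \<open>Some t\<close> is the evaluation at \<open>t\<close>.\<close>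

fun lin_functional :: "'a measure \<Rightarrow> 'a option \<Rightarrow> ('a \<Rightarrow> real) \<Rightarrow> real" where
  "lin_functional \<nu> None g = (\<integral>t. g t \<partial>\<nu>)"
| "lin_functional \<nu> (Some t) g = g t"

fun functional_cov ::
    "real \<Rightarrow> ('a \<Rightarrow> 'a \<Rightarrow> real) \<Rightarrow> 'a measure \<Rightarrow> 'a option \<Rightarrow> 'a option \<Rightarrow> real" where
  "functional_cov s C \<nu> None None = s\<^sup>2 * kernel_c0 C \<nu>"
| "functional_cov s C \<nu> None (Some t) = s\<^sup>2 * kernel_mean C \<nu> t"
| "functional_cov s C \<nu> (Some x) None = s\<^sup>2 * kernel_mean C \<nu> x"
| "functional_cov s C \<nu> (Some x) (Some t) = s\<^sup>2 * C x t"

text \<open>\<open>f \<omega>\<close> is the integrand drawn at the sample point \<open>\<omega>\<close>. That the integral of \<open>f \<omega>\<close> exists is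
  required to be an event of probability one (automatic measurability would need a complete
  \<open>F\<close> or a jointly measurable \<open>f\<close>). The variables are measurable by \<^const>\<open>gaussian_rv\<close>.\<close>

definition gaussian_process ::
    "'w measure \<Rightarrow> 'a measure \<Rightarrow> real \<Rightarrow> ('a \<Rightarrow> 'a \<Rightarrow> real) \<Rightarrow> ('w \<Rightarrow> 'a \<Rightarrow> real) \<Rightarrow> bool" where
  "gaussian_process F \<nu> s C f \<longleftrightarrow>
     prob_space F \<and>
     {\<omega> \<in> space F. integrable \<nu> (f \<omega>)} \<in> sets F \<and>
     (AE \<omega> in F. integrable \<nu> (f \<omega>)) \<and>
     centered_gaussian_family F (insert None (Some ` space \<nu>))
       (\<lambda>i \<omega>. lin_functional \<nu> i (f \<omega>)) (functional_cov s C \<nu>)"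

section \<open>Bayesian variation, discrepancy and confounding\<close>

definition sampling_measure ::
    "'a measure \<Rightarrow> nat \<Rightarrow> (nat \<Rightarrow> real) \<Rightarrow> (nat \<Rightarrow> 'a) \<Rightarrow> 'a set \<Rightarrow> real" where
  "sampling_measure X n w x A = (\<Sum>i<n. w i * measure (return X (x i)) A)"

definition VAR_B :: "real \<Rightarrow> ('a \<Rightarrow> real) \<Rightarrow> real" where
  "VAR_B s g = s"

definition DSC_B ::
    "('a \<Rightarrow> 'a \<Rightarrow> real) \<Rightarrow> 'a measure \<Rightarrow> nat \<Rightarrow> (nat \<Rightarrow> real) \<Rightarrow> (nat \<Rightarrow> 'a) \<Rightarrow> real" where
  "DSC_B C \<nu> n w x =
     sqrt (kernel_c0 C \<nu> - 2 * (\<Sum>i<n. kernel_mean C \<nu> (x i) * w i)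
           + (\<Sum>i<n. \<Sum>j<n. w i * C (x i) (x j) * w j))"

definition CNF_B ::
    "'a measure \<Rightarrow> real \<Rightarrow> ('a \<Rightarrow> 'a \<Rightarrow> real) \<Rightarrow> 'a measure \<Rightarrow> nat \<Rightarrow> (nat \<Rightarrow> real) \<Rightarrow> (nat \<Rightarrow> 'a) \<Rightarrow>
      ('a \<Rightarrow> real) \<Rightarrow> real" where
  "CNF_B X s C \<nu> n w x g =
     signed_integral X (\<lambda>A. measure \<nu> A - sampling_measure X n w x A) g
       / (s * sqrt (kernel_c0 C \<nu> - 2 * (\<Sum>i<n. kernel_mean C \<nu> (x i) * w i)
                    + (\<Sum>i<n. \<Sum>j<n. w i * C (x i) (x j) * w j)))"

end

theory Submission imports Defs begin

text \<open>The integration error \<open>E = \<integral>f d\<nu> - \<Sum>i<n. w i * f (x i)\<close> is a finite linear combination of the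
  functionals of a centred Gaussian family, so it is Gaussian with mean zero, and expanding its square
  by bilinearity gives the variance \<open>s\<^sup>2 V\<close>, where \<open>V\<close> is the expression under the root in the
  discrepancy. As that expression is not zero, \<open>s\<^sup>2 V > 0\<close>, and \<open>E / (s sqrt V)\<close> is standard normal
  (\<open>integration_error_gaussian\<close>, \<open>gaussian_rv_standardized\<close>). A degenerate
  Gaussian variable of mean zero would have second moment zero.

  What remains is to see that the numerator of the confounding, an integral against the signed measure
  \<open>\<eta> = \<nu> - \<nu>'\<close> with \<open>\<nu>' = \<Sum>i<n. w i * \<delta>\<^bsub>x i\<^esub>\<close>, is \<open>E\<close>. The Jordan decomposition of \<open>\<eta>\<close> cannot be read off
  as \<open>\<nu>\<close> minus \<open>\<nu>'\<close>, because \<open>\<nu>\<close> may have atoms at the nodes and the weights may have either sign. But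
  \<open>\<eta>\<close> equals \<open>\<nu>\<close> away from the finite set of nodes, so the complement of the nodes of negative mass
  is the positive part of a Hahn decomposition (\<open>hahn_set_nonneg_off_finite\<close>), and this gives the values of
  both variations (\<open>emeasure_pos_var\<close>, \<open>emeasure_neg_var\<close>). Away from the nodes the positive and the
  total variation are \<open>\<nu>\<close> and the negative one vanishes. Measures that differ only by finitely many
  atoms of finite mass have the same integrable functions, and their integrals differ by the obvious
  finite sum (\<open>integral_agree_off_finite\<close>). Hence integrability against \<open>\<bar>\<eta>\<bar>\<close> is integrability against
  \<open>\<nu>\<close>, and the signed integral is \<open>E\<close> then and \<open>0\<close> otherwise
  (\<open>signed_integral_minus_sampling_measure\<close>). The equivalence matters on the null set of draws that are not
  integrable as well: it makes the confounding a measurable function of the sample point.\<close>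

section \<open>Linear combinations of Gaussian variables\<close>

lemma gaussian_rv_borel_measurable: "gaussian_rv F Z \<Longrightarrow> Z \<in> borel_measurable F"
  by (simp add: gaussian_rv_def)

text \<open>Covariances are Bochner integrals, which are \<open>0\<close> by convention when the integrand is not
  integrable. Square integrability of Gaussian variables is what licenses expanding the second moment
  of a linear combination term by term.\<close>

lemma (in prob_space) gaussian_rv_square_integrable:
  assumes "gaussian_rv M Z"
  shows "integrable M (\<lambda>\<omega>. (Z \<omega>)\<^sup>2)"
proof -
  note [measurable] = gaussian_rv_borel_measurable[OF assms]
  consider m \<sigma> where "0 < \<sigma>" "distributed M lborel Z (normal_density m \<sigma>)"
    | m where "AE \<omega> in M. Z \<omega> = m"
    using assms by (auto simp: gaussian_rv_def)
  then show ?thesis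
  proof cases
    case 1
    \<comment> \<open>The moments at hand are those about the mean, so the square is expanded about \<open>m\<close>.\<close>
    have centred: "integrable M (\<lambda>\<omega>. (Z \<omega> - m) ^ k)" for k :: nat
      using integrable_normal_moment[OF 1(1), of m k] distributed_integrable[OF 1(2), of "\<lambda>x. (x - m) ^ k"]
      by simp
    have "integrable M (\<lambda>\<omega>. (Z \<omega> - m) ^ 2 + 2 * m * (Z \<omega> - m) ^ 1 + m\<^sup>2)"
      by (intro Bochner_Integration.integrable_add integrable_mult_right centred) simp
    then show ?thesis
      by (simp add: power2_eq_square algebra_simps)
  next
    case 2
    then have "AE \<omega> in M. (Z \<omega>)\<^sup>2 = m\<^sup>2"
      by eventually_elim simp
    then show ?thesis
      by (subst integrable_cong_AE[where g = "\<lambda>_. m\<^sup>2"]) auto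
  qed
qed

lemma integrable_mult_of_squares:
  fixes Y Z :: "'w \<Rightarrow> real"
  assumes [measurable]: "Y \<in> borel_measurable M" "Z \<in> borel_measurable M"
    and "integrable M (\<lambda>\<omega>. (Y \<omega>)\<^sup>2)" "integrable M (\<lambda>\<omega>. (Z \<omega>)\<^sup>2)"
  shows "integrable M (\<lambda>\<omega>. Y \<omega> * Z \<omega>)"
proof (rule Bochner_Integration.integrable_bound)
  show "integrable M (\<lambda>\<omega>. (Y \<omega>)\<^sup>2 + (Z \<omega>)\<^sup>2)"
    using assms by simp
  have "\<bar>Y \<omega> * Z \<omega>\<bar> \<le> (Y \<omega>)\<^sup>2 + (Z \<omega>)\<^sup>2" for \<omega>
  proof -
    have "0 \<le> \<bar>Y \<omega>\<bar> * \<bar>Z \<omega>\<bar>"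
      by simp
    moreover have "2 * (\<bar>Y \<omega>\<bar> * \<bar>Z \<omega>\<bar>) \<le> (Y \<omega>)\<^sup>2 + (Z \<omega>)\<^sup>2"
      using sum_squares_bound[of "\<bar>Y \<omega>\<bar>" "\<bar>Z \<omega>\<bar>"] by (simp add: mult.assoc)
    ultimately show ?thesis
      unfolding abs_mult by linarith
  qed
  then show "AE \<omega> in M. norm (Y \<omega> * Z \<omega>) \<le> norm ((Y \<omega>)\<^sup>2 + (Z \<omega>)\<^sup>2)"
    by simp
qed simp

lemma sum_reindex_fibres:
  fixes b :: "'j \<Rightarrow> real"
  assumes "finite A"
  shows "(\<Sum>j\<in>A. b j * z (k j)) = (\<Sum>i\<in>k ` A. (\<Sum>j\<in>{j \<in> A. k j = i}. b j) * z i)"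
proof -
  have "(\<Sum>j\<in>A. b j * z (k j)) = (\<Sum>i\<in>k ` A. \<Sum>j\<in>{j \<in> A. k j = i}. b j * z (k j))"
    by (rule sum.image_gen[OF assms])
  also have "\<dots> = (\<Sum>i\<in>k ` A. (\<Sum>j\<in>{j \<in> A. k j = i}. b j) * z i)"
    unfolding sum_distrib_right by (intro sum.cong refl) simp
  finally show ?thesis .
qed

text \<open>The definition of a Gaussian family speaks of sums over sets of distinct indices. Here an index
  may be used several times, as nodes of a sampling measure may coincide; collecting the
  coefficients over the fibres of \<open>k\<close> reduces to distinct indices.\<close>

lemma gaussian_rv_linear_combination:
  assumes "centered_gaussian_family F I Z K" "finite A" "k ` A \<subseteq> I"
  shows "gaussian_rv F (\<lambda>\<omega>. \<Sum>j\<in>A. b j * Z (k j) \<omega>)"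
proof -
  have "gaussian_rv F (\<lambda>\<omega>. \<Sum>i\<in>k ` A. (\<Sum>j\<in>{j \<in> A. k j = i}. b j) * Z i \<omega>)"
    using assms unfolding centered_gaussian_family_def
    by (elim conjE allE[where x = "k ` A"]) simp
  moreover have "(\<Sum>j\<in>A. b j * Z (k j) \<omega>) =
      (\<Sum>i\<in>k ` A. (\<Sum>j\<in>{j \<in> A. k j = i}. b j) * Z i \<omega>)" for \<omega>
    using sum_reindex_fibres[OF assms(2), of b "\<lambda>i. Z i \<omega>" k] .
  ultimately show ?thesis
    by simp
qed

lemma (in prob_space) linear_combination_moments:
  fixes b :: "'j \<Rightarrow> real"
  assumes "centered_gaussian_family M I Z K" "finite A" "k ` A \<subseteq> I"
  shows "expectation (\<lambda>\<omega>. \<Sum>j\<in>A. b j * Z (k j) \<omega>) = 0"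
    and "expectation (\<lambda>\<omega>. (\<Sum>j\<in>A. b j * Z (k j) \<omega>)\<^sup>2) =
      (\<Sum>i\<in>A. \<Sum>j\<in>A. b i * b j * K (k i) (k j))"
proof -
  have kI: "k j \<in> I" if "j \<in> A" for j
    using assms(3) that by auto
  have gauss: "gaussian_rv M (Z (k j))" if "j \<in> A" for j
    using gaussian_rv_linear_combination[OF assms(1), of "{j}" k "\<lambda>_. 1"] that kI by simp
  have square: "integrable M (\<lambda>\<omega>. (Z (k j) \<omega>)\<^sup>2)" if "j \<in> A" for j
    by (intro gaussian_rv_square_integrable gauss that)
  have prod: "integrable M (\<lambda>\<omega>. Z (k i) \<omega> * Z (k j) \<omega>)" if "i \<in> A" "j \<in> A" for i j
    by (intro integrable_mult_of_squares gaussian_rv_borel_measurable gauss square that)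
  have single: "integrable M (Z (k j))" if "j \<in> A" for j
    using square_integrable_imp_integrable[OF gaussian_rv_borel_measurable[OF gauss] square] that
    by simp
  have mean: "expectation (Z (k j)) = 0" if "j \<in> A" for j
    using assms(1) kI[OF that] unfolding centered_gaussian_family_def by auto
  have cov: "expectation (\<lambda>\<omega>. Z (k i) \<omega> * Z (k j) \<omega>) = K (k i) (k j)" if "i \<in> A" "j \<in> A" for i j
    using assms(1) kI that unfolding centered_gaussian_family_def by auto
  show "expectation (\<lambda>\<omega>. \<Sum>j\<in>A. b j * Z (k j) \<omega>) = 0"
    by (simp add: Bochner_Integration.integral_sum single mean)
  have "(\<Sum>j\<in>A. b j * Z (k j) \<omega>)\<^sup>2 =
      (\<Sum>i\<in>A. \<Sum>j\<in>A. (b i * b j) * (Z (k i) \<omega> * Z (k j) \<omega>))" for \<omega>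
    by (simp add: power2_eq_square sum_product mult_ac)
  then show "expectation (\<lambda>\<omega>. (\<Sum>j\<in>A. b j * Z (k j) \<omega>)\<^sup>2) =
      (\<Sum>i\<in>A. \<Sum>j\<in>A. b i * b j * K (k i) (k j))"
    by (simp add: Bochner_Integration.integral_sum prod cov)
qed

text \<open>Of the two kinds of Gaussian variables, the degenerate one is excluded: an almost surely constant
  variable of mean zero is almost surely zero, against the positive second moment. In the other case
  the parameters of the density are recovered from the first two moments.\<close>

lemma (in prob_space) gaussian_rv_standardized:
  assumes gauss: "gaussian_rv M Z" and mean: "expectation Z = 0"
    and var: "expectation (\<lambda>\<omega>. (Z \<omega>)\<^sup>2) = \<sigma>\<^sup>2" and "0 < \<sigma>"
  shows "distributed M lborel (\<lambda>\<omega>. Z \<omega> / \<sigma>) std_normal_density"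
proof -
  note [measurable] = gaussian_rv_borel_measurable[OF gauss]
  consider m \<tau> where "0 < \<tau>" "distributed M lborel Z (normal_density m \<tau>)"
    | m where "AE \<omega> in M. Z \<omega> = m"
    using gauss by (auto simp: gaussian_rv_def)
  then show ?thesis
  proof cases
    case 1
    have "m = 0"
      using normal_distributed_expectation[OF 1] mean by simp
    moreover have "\<tau>\<^sup>2 = \<sigma>\<^sup>2"
      using normal_distributed_variance[OF 1] mean var by simp
    then have "\<tau> = \<sigma>"
      using 1(1) \<open>0 < \<sigma>\<close> by (simp add: power2_eq_iff_nonneg)
    ultimately show ?thesis
      using normal_standard_normal_convert[OF \<open>0 < \<sigma>\<close>, of Z 0] 1(2) by simp
  next
    case 2
    have "expectation Z = expectation (\<lambda>_. m)"
      using 2 by (intro integral_cong_AE) auto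
    then have "m = 0"
      using mean by (simp add: prob_space)
    then have "expectation (\<lambda>\<omega>. (Z \<omega>)\<^sup>2) = expectation (\<lambda>_. 0)"
      using 2 by (intro integral_cong_AE) auto
    then show ?thesis
      using var \<open>0 < \<sigma>\<close> by simp
  qed
qed

lemma distributed_AE_cong:
  assumes "distributed M N Y g" "Z \<in> measurable M N" "AE \<omega> in M. Z \<omega> = Y \<omega>"
  shows "distributed M N Z g"
proof -
  have "distr M N Z = distr M N Y"
    using assms by (intro distr_cong_AE) (auto simp: distributed_def)
  then show ?thesis
    using assms by (simp add: distributed_def)
qed

section \<open>Hahn and Jordan decompositions\<close>

lemma signed_measure_sums:
  fixes A :: "nat \<Rightarrow> 'a set"
  assumes "signed_measure X \<eta>" "range A \<subseteq> sets X" "disjoint_family A"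
  shows "(\<lambda>i. \<eta> (A i)) sums \<eta> (\<Union>i. A i)"
  using assms unfolding signed_measure_def by blast

text \<open>The constant series \<open>\<eta> {} + \<eta> {} + \<dots>\<close> converges.\<close>

lemma signed_measure_empty:
  assumes "signed_measure X \<eta>"
  shows "\<eta> {} = 0"
proof -
  have "(\<lambda>_ :: nat. \<eta> {}) sums \<eta> (\<Union>i :: nat. {})"
    using assms by (rule signed_measure_sums) (auto simp: disjoint_family_on_def)
  then have "summable (\<lambda>_ :: nat. \<eta> {})"
    by (rule sums_summable)
  then show ?thesis
    by (simp add: summable_const_iff)
qed

lemma signed_measure_Un:
  assumes "signed_measure X \<eta>" "A \<in> sets X" "B \<in> sets X" "A \<inter> B = {}"
  shows "\<eta> (A \<union> B) = \<eta> A + \<eta> B"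
proof -
  have "(\<lambda>i. \<eta> (binaryset A B i)) sums \<eta> (\<Union>i. binaryset A B i)"
    using assms by (intro signed_measure_sums)
      (auto simp: disjoint_family_on_def range_binaryset_eq binaryset_def split: if_splits)
  moreover have "(\<lambda>i. \<eta> (binaryset A B i)) sums (\<eta> A + \<eta> B)"
    by (rule binaryset_sums) (rule signed_measure_empty[OF assms(1)])
  ultimately show ?thesis
    by (simp add: UN_binaryset_eq sums_unique2)
qed

lemma signed_measure_finite_points:
  assumes "signed_measure X \<eta>" "finite Q" "\<And>p. p \<in> Q \<Longrightarrow> {p} \<in> sets X"
  shows "Q \<in> sets X \<and> \<eta> Q = (\<Sum>p\<in>Q. \<eta> {p})"
  using assms(2,3)
proof (induction Q rule: finite_induct)
  case empty
  then show ?case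
    by (simp add: signed_measure_empty[OF assms(1)])
next
  case (insert p Q)
  then show ?case
    using signed_measure_Un[OF assms(1), of "{p}" Q] sets.Un[of "{p}" X Q] by auto
qed

lemma signed_measure_uminus: "signed_measure X \<eta> \<Longrightarrow> signed_measure X (\<lambda>A. - \<eta> A)"
  by (auto simp: signed_measure_def intro: sums_minus)

lemma signed_measure_diff:
  "signed_measure X \<eta> \<Longrightarrow> signed_measure X \<theta> \<Longrightarrow> signed_measure X (\<lambda>A. \<eta> A - \<theta> A)"
  by (auto simp: signed_measure_def intro: sums_diff)

lemma signed_measure_finite_measure:
  "finite_measure M \<Longrightarrow> sets M = sets X \<Longrightarrow> signed_measure X (measure M)"
  by (auto simp: signed_measure_def intro!: finite_measure.finite_measure_UNION)

lemma signed_measure_sampling_measure: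
  assumes "\<And>i. i < n \<Longrightarrow> x i \<in> space X"
  shows "signed_measure X (sampling_measure X n w x)"
proof -
  have "signed_measure X (measure (return X (x i)))" if "i < n" for i
    using assms[OF that]
    by (intro signed_measure_finite_measure prob_space.finite_measure prob_space_return) auto
  then show ?thesis
    unfolding signed_measure_def sampling_measure_def
    by (auto intro!: sums_sum sums_mult)
qed

definition hahn_set :: "'a measure \<Rightarrow> ('a set \<Rightarrow> real) \<Rightarrow> 'a set \<Rightarrow> bool" where
  "hahn_set X \<eta> D \<longleftrightarrow> D \<in> sets X \<and> (\<forall>B\<in>sets X. B \<subseteq> D \<longrightarrow> 0 \<le> \<eta> B) \<and>
     (\<forall>B\<in>sets X. B \<inter> D = {} \<longrightarrow> \<eta> B \<le> 0)"

text \<open>The supremum over the measurable subsets of \<open>A\<close> is attained at \<open>A \<inter> D\<close>: discarding the part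
  of a subset outside \<open>D\<close> and adding the missing part of \<open>A \<inter> D\<close> can only increase \<open>\<eta>\<close>. Knowing the
  supremum in closed form makes its countable additivity evident, so that the positive variation does
  take these values as a measure.\<close>

lemma emeasure_pos_var:
  assumes \<eta>: "signed_measure X \<eta>" and D: "hahn_set X \<eta> D" and A: "A \<in> sets X"
  shows "emeasure (pos_var X \<eta>) A = ennreal (\<eta> (A \<inter> D))"
proof -
  have [measurable]: "D \<in> sets X"
    using D by (simp add: hahn_set_def)
  have pos: "0 \<le> \<eta> (B \<inter> D)" and neg: "\<eta> (B - D) \<le> 0" if "B \<in> sets X" for B
    using D that by (auto simp: hahn_set_def)
  have split: "\<eta> B = \<eta> (B \<inter> D) + \<eta> (B - D)" if "B \<in> sets X" for B
    using signed_measure_Un[OF \<eta>, of "B \<inter> D" "B - D"] that \<open>D \<in> sets X\<close>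
    by (simp add: Int_Diff_Un Int_Diff_disjoint)
  have sup: "(SUP B\<in>{B \<in> sets X. B \<subseteq> A}. ennreal (\<eta> B)) = ennreal (\<eta> (A \<inter> D))"
    if [measurable]: "A \<in> sets X" for A
  proof (rule antisym)
    show "ennreal (\<eta> (A \<inter> D)) \<le> (SUP B\<in>{B \<in> sets X. B \<subseteq> A}. ennreal (\<eta> B))"
      by (rule SUP_upper) auto
    show "(SUP B\<in>{B \<in> sets X. B \<subseteq> A}. ennreal (\<eta> B)) \<le> ennreal (\<eta> (A \<inter> D))"
    proof (rule SUP_least)
      fix B assume "B \<in> {B \<in> sets X. B \<subseteq> A}"
      then have [measurable]: "B \<in> sets X" and "B \<subseteq> A"
        by auto
      have "A \<inter> D = (B \<inter> D) \<union> ((A - B) \<inter> D)"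
        using \<open>B \<subseteq> A\<close> by auto
      moreover have "\<eta> ((B \<inter> D) \<union> ((A - B) \<inter> D)) = \<eta> (B \<inter> D) + \<eta> ((A - B) \<inter> D)"
        by (rule signed_measure_Un[OF \<eta>]) auto
      ultimately have "\<eta> (A \<inter> D) = \<eta> (B \<inter> D) + \<eta> ((A - B) \<inter> D)"
        by metis
      moreover have "0 \<le> \<eta> ((A - B) \<inter> D)"
        by (rule pos) simp
      ultimately show "ennreal (\<eta> B) \<le> ennreal (\<eta> (A \<inter> D))"
        using split[of B] neg[of B] \<open>B \<in> sets X\<close> by (intro ennreal_leI) linarith
    qed
  qed
  have "pos_var X \<eta> = measure_of (space X) (sets X) (\<lambda>A. ennreal (\<eta> (A \<inter> D)))"
    unfolding pos_var_def
    by (rule measure_of_eq) (auto simp: sets.space_closed sets.sigma_sets_eq sup)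
  moreover have "emeasure (measure_of (space X) (sets X) (\<lambda>A. ennreal (\<eta> (A \<inter> D)))) A =
      ennreal (\<eta> (A \<inter> D))"
  proof (rule emeasure_measure_of_sigma[OF sets.sigma_algebra_axioms _ _ A])
    show "positive (sets X) (\<lambda>A. ennreal (\<eta> (A \<inter> D)))"
      by (simp add: positive_def signed_measure_empty[OF \<eta>])
    show "countably_additive (sets X) (\<lambda>A. ennreal (\<eta> (A \<inter> D)))"
    proof (rule countably_additiveI)
      fix B :: "nat \<Rightarrow> 'a set"
      assume B: "range B \<subseteq> sets X" "disjoint_family B"
      have "(\<lambda>i. \<eta> (B i \<inter> D)) sums \<eta> (\<Union>i. B i \<inter> D)"
        using B by (intro signed_measure_sums[OF \<eta>]) (auto simp: disjoint_family_on_def)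
      moreover have "0 \<le> \<eta> (B i \<inter> D)" for i
        using B by (intro pos) auto
      ultimately show "(\<Sum>i. ennreal (\<eta> (B i \<inter> D))) = ennreal (\<eta> (\<Union> (range B) \<inter> D))"
        by (subst suminf_ennreal_eq) (auto simp: Int_UN_distrib2)
    qed
  qed
  ultimately show ?thesis
    by simp
qed

lemma sets_pos_var [simp]: "sets (pos_var X \<eta>) = sets X"
  and sets_neg_var [simp]: "sets (neg_var X \<eta>) = sets X"
  and sets_total_var [simp]: "sets (total_var X \<eta>) = sets X"
  by (simp_all add: pos_var_def neg_var_def total_var_def sets.space_closed sets.sigma_sets_eq)

text \<open>The complement of \<open>D\<close> is a positive set for \<open>- \<eta>\<close>.\<close>

lemma emeasure_neg_var:
  assumes \<eta>: "signed_measure X \<eta>" and D: "hahn_set X \<eta> D" and A: "A \<in> sets X"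
  shows "emeasure (neg_var X \<eta>) A = ennreal (- \<eta> (A - D))"
proof -
  have [measurable]: "D \<in> sets X"
    using D by (simp add: hahn_set_def)
  have "hahn_set X (\<lambda>A. - \<eta> A) (space X - D)"
    unfolding hahn_set_def
  proof (intro conjI ballI impI)
    show "space X - D \<in> sets X"
      by simp
    show "0 \<le> - \<eta> B" if "B \<in> sets X" "B \<subseteq> space X - D" for B
    proof -
      have "B \<inter> D = {}"
        using that by auto
      then show ?thesis
        using D that by (simp add: hahn_set_def)
    qed
    show "- \<eta> B \<le> 0" if "B \<in> sets X" "B \<inter> (space X - D) = {}" for B
    proof -
      have "B \<subseteq> D"
        using that sets.sets_into_space[of B X] by auto
      then show ?thesis
        using D that by (simp add: hahn_set_def)
    qed
  qed
  moreover have "A \<inter> (space X - D) = A - D"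
    using sets.sets_into_space[OF A] by auto
  ultimately show ?thesis
    using emeasure_pos_var[OF signed_measure_uminus[OF \<eta>] _ A] by (simp add: neg_var_def)
qed

lemma emeasure_total_var:
  assumes "A \<in> sets X"
  shows "emeasure (total_var X \<eta>) A = emeasure (pos_var X \<eta>) A + emeasure (neg_var X \<eta>) A"
  unfolding total_var_def
proof (rule emeasure_measure_of_sigma[OF sets.sigma_algebra_axioms _ _ assms])
  show "countably_additive (sets X) (\<lambda>A. emeasure (pos_var X \<eta>) A + emeasure (neg_var X \<eta>) A)"
    by (intro countably_additiveI) (simp add: suminf_emeasure flip: suminf_add)
qed (simp add: positive_def)

text \<open>Singletons have no proper nonempty subset, so on a finite set the sign of each point mass decides
  to which side of the decomposition the point belongs.\<close>

lemma hahn_set_nonneg_off_finite: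
  assumes \<eta>: "signed_measure X \<eta>" and P: "finite P" "\<And>p. p \<in> P \<Longrightarrow> {p} \<in> sets X"
    and nonneg: "\<And>B. B \<in> sets X \<Longrightarrow> B \<inter> P = {} \<Longrightarrow> 0 \<le> \<eta> B"
  shows "hahn_set X \<eta> (space X - {p \<in> P. \<eta> {p} < 0})"
proof -
  define N where "N = {p \<in> P. \<eta> {p} < 0}"
  have points: "Q \<in> sets X" "\<eta> Q = (\<Sum>p\<in>Q. \<eta> {p})" if "Q \<subseteq> P" for Q
    using signed_measure_finite_points[OF \<eta>, of Q] that P finite_subset[OF that] by auto
  show ?thesis
    unfolding hahn_set_def N_def[symmetric]
  proof (intro conjI ballI impI)
    show "space X - N \<in> sets X"
      using points(1)[of N] by (auto simp: N_def)
    show "0 \<le> \<eta> B" if B: "B \<in> sets X" "B \<subseteq> space X - N" for B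
    proof -
      have "\<eta> ((B - P) \<union> (B \<inter> P)) = \<eta> (B - P) + \<eta> (B \<inter> P)"
        by (rule signed_measure_Un[OF \<eta>]) (use B points(1)[of P] in auto)
      moreover have "(B - P) \<union> (B \<inter> P) = B"
        by auto
      moreover have "0 \<le> \<eta> (B - P)"
        by (rule nonneg) (use B points(1)[of P] in auto)
      moreover have "0 \<le> \<eta> (B \<inter> P)"
        unfolding points(2)[OF Int_lower2] by (rule sum_nonneg) (use B in \<open>auto simp: N_def\<close>)
      ultimately show ?thesis
        by simp
    qed
    show "\<eta> B \<le> 0" if B: "B \<in> sets X" "B \<inter> (space X - N) = {}" for B
    proof -
      have "B \<subseteq> N"
        using B sets.sets_into_space[OF B(1)] by auto
      then have "\<eta> B = (\<Sum>p\<in>B. \<eta> {p})"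
        by (intro points(2)) (auto simp: N_def)
      also have "\<dots> \<le> 0"
        by (rule sum_nonpos) (use \<open>B \<subseteq> N\<close> in \<open>auto simp: N_def\<close>)
      finally show ?thesis .
    qed
  qed
qed

lemma measure_pos_var_minus_neg_var:
  assumes \<eta>: "signed_measure X \<eta>" and D: "hahn_set X \<eta> D" and A: "A \<in> sets X"
  shows "measure (pos_var X \<eta>) A - measure (neg_var X \<eta>) A = \<eta> A"
proof -
  have [measurable]: "D \<in> sets X"
    using D by (simp add: hahn_set_def)
  have "0 \<le> \<eta> (A \<inter> D)" "\<eta> (A - D) \<le> 0"
    using D A by (auto simp: hahn_set_def)
  moreover have "\<eta> A = \<eta> (A \<inter> D) + \<eta> (A - D)"
    using signed_measure_Un[OF \<eta>, of "A \<inter> D" "A - D"] A \<open>D \<in> sets X\<close>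
    by (simp add: Int_Diff_Un Int_Diff_disjoint)
  ultimately show ?thesis
    by (simp add: measure_def emeasure_pos_var[OF \<eta> D A] emeasure_neg_var[OF \<eta> D A])
qed

section \<open>Measures that differ by finitely many atoms\<close>

text \<open>Split \<open>g\<close> into its restriction to \<open>P\<close> and to the complement. The restriction to \<open>P\<close> is a finite
  combination of indicators of points of finite mass, hence always integrable. The integral of the other
  part is the integral of \<open>g\<close> against the measure restricted to the complement, written as a density, and
  there the two measures coincide.\<close>

lemma
  fixes g :: "'a \<Rightarrow> real"
  assumes sets_eq: "sets M = sets N" and P: "finite P" "\<And>p. p \<in> P \<Longrightarrow> {p} \<in> sets N"
    and fin: "\<And>p. p \<in> P \<Longrightarrow> emeasure M {p} < \<infinity>" "\<And>p. p \<in> P \<Longrightarrow> emeasure N {p} < \<infinity>"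
    and agree: "\<And>A. A \<in> sets N \<Longrightarrow> A \<inter> P = {} \<Longrightarrow> emeasure M A = emeasure N A"
  shows integrable_agree_off_finite: "integrable M g \<longleftrightarrow> integrable N g"
    and integral_agree_off_finite: "integrable N g \<Longrightarrow>
      integral\<^sup>L M g - integral\<^sup>L N g = (\<Sum>p\<in>P. (measure M {p} - measure N {p}) * g p)"
proof -
  have space_eq: "space M = space N"
    by (rule sets_eq_imp_space_eq[OF sets_eq])
  have [measurable]: "P \<in> sets N"
    using sets.finite_UN[of P "\<lambda>p. {p}" N] P by simp
  have dens: "density M (\<lambda>t. ennreal (indicator (- P) t)) = density N (\<lambda>t. ennreal (indicator (- P) t))"
  proof (rule measure_eqI)
    fix A assume "A \<in> sets (density M (\<lambda>t. ennreal (indicator (- P) t)))"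
    then have [measurable]: "A \<in> sets N" "A \<in> sets M" "P \<in> sets M"
      by (simp_all add: sets_eq)
    have *: "ennreal (indicator (- P) t) * indicator A t = indicator (A - P) t" for t
      by (auto simp: indicator_def)
    have "emeasure M (A - P) = emeasure N (A - P)"
      by (rule agree) auto
    then show "emeasure (density M (\<lambda>t. ennreal (indicator (- P) t))) A =
        emeasure (density N (\<lambda>t. ennreal (indicator (- P) t))) A"
      by (simp add: emeasure_density *)
  qed (simp add: sets_eq)
  \<comment> \<open>Each of the two measures is compared with its restriction; \<open>L\<close> stands for either.\<close>
  have off: "integrable L (\<lambda>t. indicator (- P) t * g t) \<longleftrightarrow> integrable L g"
    "integrable L g \<Longrightarrow> integral\<^sup>L L g =
        (\<integral>t. indicator (- P) t * g t \<partial>L) + (\<Sum>p\<in>P. measure L {p} * g p)"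
    "integrable L (\<lambda>t. indicator (- P) t * g t) \<longleftrightarrow>
      integrable (density L (\<lambda>t. ennreal (indicator (- P) t))) g"
    "(\<integral>t. indicator (- P) t * g t \<partial>L) =
      integral\<^sup>L (density L (\<lambda>t. ennreal (indicator (- P) t))) g"
    if L: "sets L = sets N" "\<And>p. p \<in> P \<Longrightarrow> emeasure L {p} < \<infinity>"
      and g: "g \<in> borel_measurable N" for L
  proof -
    have [measurable]: "P \<in> sets L" "g \<in> borel_measurable L"
      using g by (simp_all add: L measurable_cong_sets[OF L(1) refl])
    have atoms: "\<And>p. p \<in> P \<Longrightarrow> {p} \<in> sets L"
      using P by (simp add: L)
    have eq: "g t = indicator (- P) t * g t + (\<Sum>p\<in>P. g p * indicator {p} t)" for t
      using P(1) by (cases "t \<in> P") (auto simp: indicator_def if_distrib sum.If_cases cong: if_cong)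
    have int_atom: "integrable L (\<lambda>t. g p * indicator {p} t)" if "p \<in> P" for p
      using atoms[OF that] L(2)[OF that] by (intro integrable_mult_right) simp
    have int_P: "integrable L (\<lambda>t. \<Sum>p\<in>P. g p * indicator {p} t)"
      by (intro Bochner_Integration.integrable_sum int_atom)
    show 1: "integrable L (\<lambda>t. indicator (- P) t * g t) \<longleftrightarrow> integrable L g"
    proof
      assume "integrable L g"
      from Bochner_Integration.integrable_diff[OF this int_P]
      have "integrable L (\<lambda>t. g t - (\<Sum>p\<in>P. g p * indicator {p} t))" .
      moreover have "g t - (\<Sum>p\<in>P. g p * indicator {p} t) = indicator (- P) t * g t" for t
        using eq[of t] by linarith
      ultimately show "integrable L (\<lambda>t. indicator (- P) t * g t)"
        by simp
    next
      assume "integrable L (\<lambda>t. indicator (- P) t * g t)"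
      from Bochner_Integration.integrable_add[OF this int_P]
      show "integrable L g"
        by (simp flip: eq)
    qed
    show "integral\<^sup>L L g =
        (\<integral>t. indicator (- P) t * g t \<partial>L) + (\<Sum>p\<in>P. measure L {p} * g p)" if "integrable L g"
    proof -
      have "integral\<^sup>L L g =
          (\<integral>t. indicator (- P) t * g t + (\<Sum>p\<in>P. g p * indicator {p} t) \<partial>L)"
        by (simp flip: eq)
      also have "\<dots> = (\<integral>t. indicator (- P) t * g t \<partial>L) + (\<integral>t. (\<Sum>p\<in>P. g p * indicator {p} t) \<partial>L)"
        using that 1 int_P by (intro Bochner_Integration.integral_add) auto
      also have "(\<integral>t. (\<Sum>p\<in>P. g p * indicator {p} t) \<partial>L) =
          (\<Sum>p\<in>P. \<integral>t. g p * indicator {p} t \<partial>L)"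
        by (intro Bochner_Integration.integral_sum int_atom)
      also have "\<dots> = (\<Sum>p\<in>P. measure L {p} * g p)"
        using atoms[THEN sets.sets_into_space] by (intro sum.cong) auto
      finally show ?thesis .
    qed
    show "integrable L (\<lambda>t. indicator (- P) t * g t) \<longleftrightarrow>
        integrable (density L (\<lambda>t. ennreal (indicator (- P) t))) g"
      by (subst integrable_density) auto
    show "(\<integral>t. indicator (- P) t * g t \<partial>L) =
        integral\<^sup>L (density L (\<lambda>t. ennreal (indicator (- P) t))) g"
      by (subst integral_density) auto
  qed
  note offM = off[OF sets_eq fin(1)] and offN = off[OF refl fin(2)]
  have meas: "g \<in> borel_measurable N" if "integrable M g \<or> integrable N g"
    using that sets_eq by (auto simp: measurable_cong_sets[OF sets_eq refl] dest: borel_measurable_integrable)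
  show iff: "integrable M g \<longleftrightarrow> integrable N g"
  proof (cases "g \<in> borel_measurable N")
    case True
    then show ?thesis
      using offM(1,3)[OF _ True] offN(1,3)[OF _ True] dens by metis
  qed (use meas in blast)
  show "integral\<^sup>L M g - integral\<^sup>L N g = (\<Sum>p\<in>P. (measure M {p} - measure N {p}) * g p)"
    if "integrable N g"
  proof -
    have g: "g \<in> borel_measurable N"
      using that by simp
    show ?thesis
      using offM(2,4)[OF _ g] offN(2,4)[OF _ g] that iff dens
      by (simp add: left_diff_distrib sum_subtractf)
  qed
qed

section \<open>Integrals against the difference of the measures\<close>

text \<open>The positive variation is compared with \<open>\<nu>\<close> and the negative one with the zero measure. The atoms
  of \<open>\<nu>\<close> cancel in the difference of the two correction sums, and only the masses of the sampling
  measure at the nodes are left. The right-hand side is the value for every \<open>g\<close>, measurable or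
  not.\<close>

lemma signed_integral_minus_sampling_measure:
  assumes \<nu>: "finite_measure \<nu>" "sets \<nu> = sets X"
    and x: "\<And>i. i < n \<Longrightarrow> x i \<in> space X" "\<And>i. i < n \<Longrightarrow> {x i} \<in> sets X"
  shows "signed_integral X (\<lambda>A. measure \<nu> A - sampling_measure X n w x A) g =
    (if integrable \<nu> g then (\<integral>t. g t \<partial>\<nu>) - (\<Sum>i<n. w i * g (x i)) else 0)"
proof -
  interpret \<nu>: finite_measure \<nu> by fact
  define \<eta> where "\<eta> = (\<lambda>A. measure \<nu> A - sampling_measure X n w x A)"
  define P where "P = x ` {..<n}"
  define D where "D = space X - {p \<in> P. \<eta> {p} < 0}"
  have P: "finite P" "\<And>p. p \<in> P \<Longrightarrow> {p} \<in> sets X"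
    using x by (auto simp: P_def)
  have \<eta>: "signed_measure X \<eta>"
    unfolding \<eta>_def using \<nu> x
    by (intro signed_measure_diff signed_measure_finite_measure signed_measure_sampling_measure)
  have off: "\<eta> A = measure \<nu> A" if "A \<in> sets X" "A \<inter> P = {}" for A
  proof -
    have "sampling_measure X n w x A = 0"
      unfolding sampling_measure_def
      by (rule sum.neutral) (use that in \<open>auto simp: measure_return P_def indicator_def\<close>)
    then show ?thesis
      by (simp add: \<eta>_def)
  qed
  have D: "hahn_set X \<eta> D"
    unfolding D_def by (rule hahn_set_nonneg_off_finite[OF \<eta> P]) (simp_all add: off)
  have pos_off: "emeasure (pos_var X \<eta>) A = emeasure \<nu> A"
    and neg_off: "emeasure (neg_var X \<eta>) A = 0" if A: "A \<in> sets X" "A \<inter> P = {}" for A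
  proof -
    have "A \<inter> D = A" "A - D = {}"
      using A sets.sets_into_space[OF A(1)] by (auto simp: D_def)
    then show "emeasure (pos_var X \<eta>) A = emeasure \<nu> A" "emeasure (neg_var X \<eta>) A = 0"
      unfolding emeasure_pos_var[OF \<eta> D A(1)] emeasure_neg_var[OF \<eta> D A(1)]
      using A by (simp_all only: off \<nu>.emeasure_eq_measure signed_measure_empty[OF \<eta>]) simp
  qed
  have fin: "emeasure (pos_var X \<eta>) {p} < \<infinity>" "emeasure (neg_var X \<eta>) {p} < \<infinity>"
    "emeasure (total_var X \<eta>) {p} < \<infinity>" "emeasure \<nu> {p} < \<infinity>" if "p \<in> P" for p
    using P(2)[OF that] by (simp_all add: emeasure_pos_var[OF \<eta> D] emeasure_neg_var[OF \<eta> D]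
        emeasure_total_var \<nu>.emeasure_eq_measure)
  have P': "\<And>p. p \<in> P \<Longrightarrow> {p} \<in> sets \<nu>"
    using P \<nu> by simp
  have total: "integrable (total_var X \<eta>) g \<longleftrightarrow> integrable \<nu> g"
    by (rule integrable_agree_off_finite[OF _ P(1) P' fin(3,4)])
      (simp_all add: \<nu> emeasure_total_var pos_off neg_off)
  have integral_eq: "integral\<^sup>L (pos_var X \<eta>) g - integral\<^sup>L (neg_var X \<eta>) g =
      integral\<^sup>L \<nu> g - (\<Sum>i<n. w i * g (x i))" if g: "integrable \<nu> g"
  proof -
    have meas: "g \<in> borel_measurable X"
      using borel_measurable_integrable[OF g] by (simp add: measurable_cong_sets[OF \<nu>(2) refl])
    have pos: "integral\<^sup>L (pos_var X \<eta>) g - integral\<^sup>L \<nu> g =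
        (\<Sum>p\<in>P. (measure (pos_var X \<eta>) {p} - measure \<nu> {p}) * g p)"
      by (rule integral_agree_off_finite[OF _ P(1) P' fin(1,4) _ g]) (simp_all add: \<nu> pos_off)
    have neg: "integral\<^sup>L (neg_var X \<eta>) g - integral\<^sup>L (null_measure X) g =
        (\<Sum>p\<in>P. (measure (neg_var X \<eta>) {p} - measure (null_measure X) {p}) * g p)"
      by (rule integral_agree_off_finite[OF _ P(1) _ fin(2)]) (simp_all add: P neg_off meas)
    have "integral\<^sup>L (pos_var X \<eta>) g - integral\<^sup>L (neg_var X \<eta>) g - integral\<^sup>L \<nu> g =
        (\<Sum>p\<in>P. (measure (pos_var X \<eta>) {p} - measure (neg_var X \<eta>) {p} - measure \<nu> {p}) * g p)"
      using pos neg by (simp add: left_diff_distrib sum_subtractf)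
    also have "\<dots> = - (\<Sum>p\<in>P. sampling_measure X n w x {p} * g p)"
      unfolding sum_negf[symmetric]
    proof (rule sum.cong[OF refl])
      fix p assume "p \<in> P"
      then have "measure (pos_var X \<eta>) {p} - measure (neg_var X \<eta>) {p} - measure \<nu> {p} =
          - sampling_measure X n w x {p}"
        using measure_pos_var_minus_neg_var[OF \<eta> D P(2)[OF \<open>p \<in> P\<close>]] by (simp add: \<eta>_def)
      then show "(measure (pos_var X \<eta>) {p} - measure (neg_var X \<eta>) {p} - measure \<nu> {p}) * g p =
          - (sampling_measure X n w x {p} * g p)"
        by simp
    qed
    also have "(\<Sum>p\<in>P. sampling_measure X n w x {p} * g p) =
        (\<Sum>p\<in>x ` {..<n}. (\<Sum>i\<in>{i \<in> {..<n}. x i = p}. w i) * g p)"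
    proof (rule sum.cong)
      fix p assume "p \<in> x ` {..<n}"
      then have "sampling_measure X n w x {p} = (\<Sum>i<n. if x i = p then w i else 0)"
        unfolding sampling_measure_def
        by (intro sum.cong) (use x in \<open>auto simp: measure_return indicator_def\<close>)
      also have "\<dots> = (\<Sum>i\<in>{i \<in> {..<n}. x i = p}. w i)"
        by (rule sum.inter_filter[symmetric]) simp
      finally show "sampling_measure X n w x {p} * g p =
          (\<Sum>i\<in>{i \<in> {..<n}. x i = p}. w i) * g p"
        by simp
    qed (simp add: P_def)
    also have "\<dots> = (\<Sum>i<n. w i * g (x i))"
      by (rule sum_reindex_fibres[symmetric]) simp
    finally show ?thesis
      by simp
  qed
  show ?thesis
    unfolding signed_integral_def \<eta>_def[symmetric] using total integral_eq by simp
qed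

section \<open>The integration error\<close>

text \<open>The functionals are indexed by \<^typ>\<open>nat option\<close>, with \<^const>\<open>None\<close> for the integral with
  coefficient \<open>1\<close> and \<open>Some i\<close> for the evaluation at the \<open>i\<close>-th node with coefficient \<open>- w i\<close>.\<close>

lemma integration_error_gaussian:
  fixes w :: "nat \<Rightarrow> real"
  assumes f: "gaussian_process F \<nu> s C f" and x: "\<And>i. i < n \<Longrightarrow> x i \<in> space \<nu>"
  defines "E \<equiv> \<lambda>\<omega>. (\<integral>t. f \<omega> t \<partial>\<nu>) - (\<Sum>i<n. w i * f \<omega> (x i))"
  shows "gaussian_rv F E" and "(\<integral>\<omega>. E \<omega> \<partial>F) = 0"
    and "(\<integral>\<omega>. (E \<omega>)\<^sup>2 \<partial>F) = s\<^sup>2 * (kernel_c0 C \<nu> - 2 * (\<Sum>i<n. kernel_mean C \<nu> (x i) * w i)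
           + (\<Sum>i<n. \<Sum>j<n. w i * C (x i) (x j) * w j))"
proof -
  interpret prob_space F
    using f by (simp add: gaussian_process_def)
  define A where "A = insert None (Some ` {..<n})"
  define b where "b = case_option 1 (\<lambda>i. - w i)"
  have sum_A: "(\<Sum>j\<in>A. h j) = h None + (\<Sum>i<n. h (Some i))" for h :: "nat option \<Rightarrow> real"
    unfolding A_def by (subst sum.insert) (auto simp: sum.reindex)
  have family: "centered_gaussian_family F (insert None (Some ` space \<nu>))
      (\<lambda>i \<omega>. lin_functional \<nu> i (f \<omega>)) (functional_cov s C \<nu>)"
    using f by (simp add: gaussian_process_def)
  have A: "finite A" "map_option x ` A \<subseteq> insert None (Some ` space \<nu>)"
    using x by (auto simp: A_def)
  have E: "E = (\<lambda>\<omega>. \<Sum>j\<in>A. b j * lin_functional \<nu> (map_option x j) (f \<omega>))"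
    by (simp add: E_def sum_A b_def sum_negf)
  show "gaussian_rv F E"
    unfolding E by (rule gaussian_rv_linear_combination[OF family A])
  show "(\<integral>\<omega>. E \<omega> \<partial>F) = 0"
    unfolding E by (rule linear_combination_moments(1)[OF family A])
  have "(\<integral>\<omega>. (E \<omega>)\<^sup>2 \<partial>F) = (\<Sum>i\<in>A. \<Sum>j\<in>A.
      b i * b j * functional_cov s C \<nu> (map_option x i) (map_option x j))"
    unfolding E by (rule linear_combination_moments(2)[OF family A])
  also have "\<dots> = s\<^sup>2 * (kernel_c0 C \<nu> - 2 * (\<Sum>i<n. kernel_mean C \<nu> (x i) * w i)
      + (\<Sum>i<n. \<Sum>j<n. w i * C (x i) (x j) * w j))"
    by (simp add: sum_A b_def sum.distrib sum_negf sum_subtractf sum_distrib_left algebra_simps)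
  finally show "(\<integral>\<omega>. (E \<omega>)\<^sup>2 \<partial>F) = s\<^sup>2 * (kernel_c0 C \<nu> - 2 * (\<Sum>i<n. kernel_mean C \<nu> (x i) * w i)
      + (\<Sum>i<n. \<Sum>j<n. w i * C (x i) (x j) * w j))" .
qed

theorem theorem3:
  fixes X :: "'a measure" and \<nu> :: "'a measure" and s :: real
    and C :: "'a \<Rightarrow> 'a \<Rightarrow> real"
    and F :: "'w measure" and f :: "'w \<Rightarrow> 'a \<Rightarrow> real"
    and n :: nat and w :: "nat \<Rightarrow> real" and x :: "nat \<Rightarrow> 'a"
  assumes "\<And>t. t \<in> space X \<Longrightarrow> {t} \<in> sets X"
    and "prob_space \<nu>" and "sets \<nu> = sets X"
    and "0 < s"
    and "covariance_kernel (space X) C"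
    and "measure \<nu> \<in> kernel_measures X C"
    and "\<And>t. t \<in> space X \<Longrightarrow> measure (return X t) \<in> kernel_measures X C"
    and "gaussian_process F \<nu> s C f"
    and "\<And>i. i < n \<Longrightarrow> x i \<in> space X"
    and "s * DSC_B C \<nu> n w x \<noteq> 0"
  shows "(AE \<omega> in F. (\<integral>t. f \<omega> t \<partial>\<nu>) - (\<Sum>i<n. w i * f \<omega> (x i)) =
            CNF_B X s C \<nu> n w x (f \<omega>) * DSC_B C \<nu> n w x * VAR_B s (f \<omega>))
         \<and> distributed F lborel (\<lambda>\<omega>. CNF_B X s C \<nu> n w x (f \<omega>)) std_normal_density"
proof -
  interpret F: prob_space F
    using assms(8) by (simp add: gaussian_process_def)
  interpret \<nu>: prob_space \<nu> by fact
  have space_eq: "space \<nu> = space X"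
    by (rule sets_eq_imp_space_eq) fact
  define V where "V = kernel_c0 C \<nu> - 2 * (\<Sum>i<n. kernel_mean C \<nu> (x i) * w i)
           + (\<Sum>i<n. \<Sum>j<n. w i * C (x i) (x j) * w j)"
  define E where "E = (\<lambda>\<omega>. (\<integral>t. f \<omega> t \<partial>\<nu>) - (\<Sum>i<n. w i * f \<omega> (x i)))"
  have x: "\<And>i. i < n \<Longrightarrow> x i \<in> space \<nu>"
    using assms(9) space_eq by simp
  have error: "gaussian_rv F E" "F.expectation E = 0" "F.expectation (\<lambda>\<omega>. (E \<omega>)\<^sup>2) = s\<^sup>2 * V"
    unfolding E_def V_def by (rule integration_error_gaussian[OF assms(8) x]; assumption)+
  have CNF: "CNF_B X s C \<nu> n w x g = (if integrable \<nu> g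
      then ((\<integral>t. g t \<partial>\<nu>) - (\<Sum>i<n. w i * g (x i))) / (s * sqrt V) else 0)" for g
    using signed_integral_minus_sampling_measure[OF \<nu>.finite_measure_axioms assms(3), of n x w g]
      assms(1,9) unfolding CNF_B_def V_def by simp
  have DSC: "DSC_B C \<nu> n w x = sqrt V"
    by (simp add: DSC_B_def V_def)
  \<comment> \<open>The sign of \<open>V\<close> must be established, since \<open>sqrt\<close> also has values at negative arguments.\<close>
  have "0 \<le> s\<^sup>2 * V"
    unfolding error(3)[symmetric] by simp
  moreover have "V \<noteq> 0"
    using assms(10) by (auto simp: DSC)
  ultimately have "0 < V"
    using \<open>0 < s\<close> by (simp add: zero_le_mult_iff)
  have integrable: "AE \<omega> in F. integrable \<nu> (f \<omega>)"
    and event: "{\<omega> \<in> space F. integrable \<nu> (f \<omega>)} \<in> sets F"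
    using assms(8) by (simp_all add: gaussian_process_def)
  have AE_CNF: "AE \<omega> in F. CNF_B X s C \<nu> n w x (f \<omega>) = E \<omega> / (s * sqrt V)"
    using integrable by eventually_elim (simp add: CNF E_def)
  have [measurable]: "E \<in> borel_measurable F"
    by (rule gaussian_rv_borel_measurable) (rule error)
  have "distributed F lborel (\<lambda>\<omega>. E \<omega> / (s * sqrt V)) std_normal_density"
    using \<open>0 < s\<close> \<open>0 < V\<close> error
    by (intro F.gaussian_rv_standardized) (simp_all add: power_mult_distrib)
  \<comment> \<open>Almost sure equality with a measurable function does not suffice here, as \<open>F\<close> may be incomplete.\<close>
  moreover have "(\<lambda>\<omega>. CNF_B X s C \<nu> n w x (f \<omega>)) \<in> measurable F lborel"
  proof -
    have "(\<lambda>\<omega>. if integrable \<nu> (f \<omega>) then E \<omega> / (s * sqrt V) else 0) \<in> borel_measurable F"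
      using event by (intro measurable_If) auto
    moreover have "(\<lambda>\<omega>. CNF_B X s C \<nu> n w x (f \<omega>)) =
        (\<lambda>\<omega>. if integrable \<nu> (f \<omega>) then E \<omega> / (s * sqrt V) else 0)"
      by (simp add: CNF E_def fun_eq_iff)
    ultimately show ?thesis
      by simp
  qed
  ultimately have "distributed F lborel (\<lambda>\<omega>. CNF_B X s C \<nu> n w x (f \<omega>)) std_normal_density"
    using AE_CNF by (rule distributed_AE_cong)
  moreover have "AE \<omega> in F. (\<integral>t. f \<omega> t \<partial>\<nu>) - (\<Sum>i<n. w i * f \<omega> (x i)) =
      CNF_B X s C \<nu> n w x (f \<omega>) * DSC_B C \<nu> n w x * VAR_B s (f \<omega>)"
    using AE_CNF by eventually_elim (use \<open>0 < s\<close> \<open>0 < V\<close> in \<open>simp add: DSC VAR_B_def E_def\<close>)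
  ultimately show ?thesis
    by blast
qed

end
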